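(* Let $n$ be odd and squarefree with $\Omega(n)=3$ and every prime divisor of $n$ at least $7$. Let $p'$ be a prime divisor of $n$ and $A=L(n;p')$. Then a sequence $S$ in $\mathbb{Z}_n$ is an $A$-extremal sequence for the Davenport constant if $S$ is equivalent with respect to $A$ to a sequence $(y_1,y_2,y_3)$ of either of the following forms: (i) $y_3\neq 0$, $y_3$ is divisible by $n'=n/p'$, and the image of $(y_1,y_2)$ under the natural map $\mathbb{Z}_n\to\mathbb{Z}_{n'}$ is an $S(n')$-extremal sequence for the Davenport constant; (ii) there is a prime divisor $p$ of $n$ such that $y_1$ is the only term not divisible by $p$, and, with $n'=n/p$ and $T'$ the image of $(y_2,y_3)$ under the natural map $\mathbb{Z}_n\to\mathbb{Z}_{n'}$: if $p\neq p'$ then $T'$ is a $U(n')$-extremal sequence for the Davenport constant, and if $p=p'$ then $T'$ is an $S(n')$-extremal sequence for the Davenport constant.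
   Context: $\mathbb{Z}_m$ is the integers mod $m$, $U(m)$ its unit group. For nonempty $A\subseteq\mathbb{Z}_m\setminus\{0\}$, a sequence $(x_1,\ldots,x_k)$ is an $A$-weighted zero-sum sequence if $\sum a_ix_i=0$ for some $a_i\in A$; $D_A(m)$ is the least $k$ such that every length-$k$ sequence in $\mathbb{Z}_m$ has a nonempty $A$-weighted zero-sum subsequence; an $A$-extremal sequence for the Davenport constant is a sequence of length $D_A(m)-1$ with no $A$-weighted zero-sum subsequence. For a multiplicative group $A$, $(x_1,\ldots,x_k)$ and $(y_1,\ldots,y_k)$ are equivalent with respect to $A$ if there are $a_i\in A$, a unit $c$ and a permutation $\sigma$ with $y_{\sigma(i)}=c\,a_ix_i$ for all $i$. $\Omega(n)$ is the number of prime factors with multiplicity. For odd $m=\prod p_i^{r_i}$, prime $p\mid m$ and $a\in U(m)$, $\left(\frac{a}{p}\right)$ is the Legendre symbol of the image mod $p$, $\left(\frac{a}{m}\right)=\prod\left(\frac{a}{p_i}\right)^{r_i}$, $S(m)$ is the kernel of $a\mapsto\left(\frac{a}{m}\right)$ on $U(m)$, and $L(m;p')=\{a\in U(m):\left(\frac{a}{m}\right)=\left(\frac{a}{p'}\right)\}$ for a prime $p'\mid m$. *)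

theory Defs
  imports "HOL-Number_Theory.Number_Theory" "HOL-Combinatorics.Permutations" "HOL-Computational_Algebra.Squarefree"
begin

text \<open>Elements of Z_m are represented by integers in {0..<m}; sequences by lists.
  Weights are integer representatives; all equations are congruences mod m.\<close>

definition Zm :: "int \<Rightarrow> int set" where
  "Zm m = {0..<m}"

definition units_mod :: "int \<Rightarrow> int set" where
  "units_mod m = {a \<in> {0..<m}. coprime a m}"

definition has_wzs :: "int \<Rightarrow> int set \<Rightarrow> int list \<Rightarrow> bool" where
  "has_wzs m A xs \<longleftrightarrow> (\<exists>I w. I \<subseteq> {..<length xs} \<and> I \<noteq> {} \<and> (\<forall>i\<in>I. w i \<in> A) \<and>
       [(\<Sum>i\<in>I. w i * xs ! i) = 0] (mod m))"

definition davenport :: "int \<Rightarrow> int set \<Rightarrow> nat" where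
  "davenport m A = (LEAST k. \<forall>xs. length xs = k \<and> set xs \<subseteq> Zm m \<longrightarrow> has_wzs m A xs)"

definition extremal :: "int \<Rightarrow> int set \<Rightarrow> int list \<Rightarrow> bool" where
  "extremal m A xs \<longleftrightarrow> set xs \<subseteq> Zm m \<and> length xs = davenport m A - 1 \<and> \<not> has_wzs m A xs"

definition equiv_wrt :: "int \<Rightarrow> int set \<Rightarrow> int list \<Rightarrow> int list \<Rightarrow> bool" where
  "equiv_wrt m A xs ys \<longleftrightarrow> length xs = length ys \<and>
     (\<exists>a c \<sigma>. (\<forall>i<length xs. a i \<in> A) \<and> c \<in> units_mod m \<and> \<sigma> permutes {..<length xs} \<and>
        (\<forall>i<length xs. [ys ! (\<sigma> i) = c * a i * xs ! i] (mod m)))"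

definition Omega :: "int \<Rightarrow> nat" where
  "Omega n = size (prime_factorization n)"

definition jacobi_sym :: "int \<Rightarrow> int \<Rightarrow> int" where
  "jacobi_sym a m = (\<Prod>p\<in>prime_factors m. Legendre a p ^ multiplicity p m)"

definition S_grp :: "int \<Rightarrow> int set" where
  "S_grp m = {a \<in> units_mod m. jacobi_sym a m = 1}"

definition L_grp :: "int \<Rightarrow> int \<Rightarrow> int set" where
  "L_grp m p' = {a \<in> units_mod m. jacobi_sym a m = Legendre a p'}"

end

(* Write n = p' p q. By the Chinese remainder theorem, A = L(n;p') consists of the weights that are
   arbitrary units mod p' and whose Legendre symbols mod p and mod q agree.

   Upper bound for the Davenport constant: a sum of at least three nonzero terms mod a prime >= 7 can
   be made zero with weights of arbitrarily prescribed Legendre symbols, since every nonzero t has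
   the form a x^2 + b y^2 with x, y nonzero; for exactly two nonzero terms only the product of the two
   symbols is constrained; and exactly one nonzero term is impossible. So a set I of indices carries a
   weighted zero-sum as soon as no prime has exactly one nonzero term in I and the nonzero terms mod p
   and mod q do not form the same pair. Among any four indices there is such a nonempty I.

   For the forms (i) and (ii), a weighted zero-sum projects to one of the shorter sequence mod n': in
   (i), y_3 vanishes mod n' but cannot be a zero-sum alone; in (ii), y_1 cannot occur in the sum. *)
theory Submission
  imports Defs
begin

section \<open>Legendre symbols and binary quadratic forms\<close>

lemma Legendre_cong:
  assumes "[a = b] (mod p)"
  shows "Legendre a p = Legendre b p"
proof -
  have "[x = a] (mod p) \<longleftrightarrow> [x = b] (mod p)" for x
    using assms cong_trans cong_sym by blast
  moreover have "[a = 0] (mod p) \<longleftrightarrow> [b = 0] (mod p)"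
    using assms cong_trans cong_sym by blast
  ultimately show ?thesis
    by (simp add: Legendre_def QuadRes_def)
qed

lemma Legendre_eq_0_iff: "Legendre a p = 0 \<longleftrightarrow> p dvd a"
  by (simp add: Legendre_def cong_0_iff)

lemma Legendre_cases: "\<not> p dvd a \<Longrightarrow> Legendre a p = 1 \<or> Legendre a p = -1"
  by (auto simp: Legendre_def cong_0_iff)

text \<open>Euler's criterion gives the identity modulo \<open>p\<close>; both sides have absolute
  value at most 1, so their difference, a multiple of \<open>p > 2\<close>, is zero.\<close>

lemma Legendre_mult:
  fixes p :: int
  assumes "prime p" "2 < p"
  shows "Legendre (a * b) p = Legendre a p * Legendre b p"
proof -
  have p: "prime (nat p)" "2 < nat p" "int (nat p) = p"
    using assms by auto
  define h where "h = (nat p - 1) div 2"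
  have euler: "[Legendre x p = x ^ h] (mod p)" for x
    using euler_criterion[OF p(1,2), of x] p(3) unfolding h_def by simp
  have "[Legendre (a * b) p = Legendre a p * Legendre b p] (mod p)"
    using euler[of "a * b"] cong_mult[OF euler[of a] euler[of b]]
    by (metis cong_sym cong_trans power_mult_distrib)
  hence "p dvd Legendre (a * b) p - Legendre a p * Legendre b p"
    by (simp add: cong_iff_dvd_diff)
  moreover have "\<bar>Legendre x p\<bar> \<le> 1" for x
    by (simp add: Legendre_def)
  hence "\<bar>Legendre (a * b) p\<bar> \<le> 1" "\<bar>Legendre a p * Legendre b p\<bar> \<le> 1"
    by (auto simp: abs_mult intro: mult_le_one)
  hence "\<bar>Legendre (a * b) p - Legendre a p * Legendre b p\<bar> < p"
    using assms(2) by linarith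
  ultimately show ?thesis
    using zdvd_not_zless[of "\<bar>Legendre (a * b) p - Legendre a p * Legendre b p\<bar>" p] by fastforce
qed

lemma Legendre_square:
  fixes p :: int
  assumes "\<not> p dvd z" "prime p"
  shows "Legendre (z\<^sup>2) p = 1"
proof -
  have "QuadRes p (z\<^sup>2)" unfolding QuadRes_def by (metis cong_refl)
  thus ?thesis using assms by (simp add: Legendre_def cong_0_iff prime_dvd_power_iff)
qed

lemma inverse_mod_prime:
  fixes p :: int
  assumes "prime p" "\<not> p dvd a"
  obtains b where "[a * b = 1] (mod p)" "\<not> p dvd b"
proof -
  obtain b where b: "[a * b = 1] (mod p)"
    using cong_solve_coprime_int[of a p] assms prime_imp_coprime[of p a] coprime_commute by blast
  moreover have "\<not> p dvd b"
  proof
    assume "p dvd b"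
    hence "p dvd 1" using b by (meson cong_dvd_iff dvd_mult)
    thus False using assms(1) not_prime_unit by blast
  qed
  ultimately show thesis using that by blast
qed

text \<open>The product of two nonzero elements of the same class is a square
  \<open>s\<^sup>2\<close>, and \<open>z = s / v\<close> then satisfies
  \<open>v * z\<^sup>2 = u\<close> modulo \<open>p\<close>.\<close>

lemma same_Legendre_imp_square_ratio:
  fixes p :: int
  assumes p: "prime p" "2 < p" and nz: "\<not> p dvd u" and eq: "Legendre u p = Legendre v p"
  obtains z where "\<not> p dvd z" "[u = v * z\<^sup>2] (mod p)"
proof -
  have nv: "\<not> p dvd v" using nz eq Legendre_eq_0_iff by metis
  have "Legendre (u * v) p = 1"
    using Legendre_mult[OF p, of u v] eq Legendre_cases[OF nz] by auto
  then obtain s where s: "[s\<^sup>2 = u * v] (mod p)"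
    by (auto simp: Legendre_def QuadRes_def split: if_splits)
  obtain w where w: "[v * w = 1] (mod p)" "\<not> p dvd w"
    using inverse_mod_prime[OF p(1) nv] by blast
  have "\<not> p dvd s\<^sup>2"
    using s nz nv p(1) by (metis cong_dvd_iff prime_dvd_mult_iff)
  hence "\<not> p dvd s" using dvd_trans power2_eq_square dvd_triv_left by metis
  hence "\<not> p dvd s * w" using w p(1) by (simp add: prime_dvd_mult_iff)
  moreover have "[u = v * (s * w)\<^sup>2] (mod p)"
  proof -
    have "[s\<^sup>2 * (v * w\<^sup>2) = (u * v) * (v * w\<^sup>2)] (mod p)"
      using s cong_mult cong_refl by blast
    moreover have "[u * (v * w)\<^sup>2 = u * 1\<^sup>2] (mod p)"
      using w(1) cong_mult cong_refl cong_pow by blast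
    ultimately have "[v * (s * w)\<^sup>2 = u] (mod p)"
      by (simp add: power2_eq_square algebra_simps) (metis cong_trans)
    thus ?thesis by (rule cong_sym)
  qed
  ultimately show thesis using that by blast
qed

text \<open>Squaring is not injective on the finite set \<open>{1..<p}\<close>, hence not surjective.\<close>

lemma exists_nonresidue:
  fixes p :: int
  assumes p: "prime p" "2 < p"
  obtains g where "0 < g" "g < p" "Legendre g p = -1"
proof -
  define f where "f = (\<lambda>x. x\<^sup>2 mod p)"
  have "f ` {1..<p} \<subseteq> {1..<p}"
  proof (rule image_subsetI)
    fix x assume "x \<in> {1..<p}"
    hence x: "1 \<le> x" "x < p" by auto
    hence "\<not> p dvd x" using zdvd_not_zless by force
    hence "\<not> p dvd x\<^sup>2" using p(1) by (simp add: prime_dvd_power_iff)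
    hence "x\<^sup>2 mod p \<noteq> 0" by (simp add: mod_eq_0_iff_dvd)
    thus "f x \<in> {1..<p}"
      using p(2) pos_mod_bound[of p "x\<^sup>2"] pos_mod_sign[of p "x\<^sup>2"]
      unfolding f_def atLeastLessThan_iff by linarith
  qed
  moreover have "f 1 = f (p - 1)"
  proof -
    have "(p - 1)\<^sup>2 - 1\<^sup>2 = p * (p - 2)" by (simp add: power2_eq_square algebra_simps)
    hence "[(p - 1)\<^sup>2 = 1\<^sup>2] (mod p)" by (metis cong_iff_dvd_diff dvd_triv_left)
    thus ?thesis by (simp only: f_def cong_def)
  qed
  hence "\<not> inj_on f {1..<p}"
    using p(2) by (auto dest!: inj_onD[of f _ 1 "p - 1"])
  ultimately have "f ` {1..<p} \<noteq> {1..<p}"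
    using eq_card_imp_inj_on[of "{1..<p}" f] by fastforce
  then obtain g where g: "1 \<le> g" "g < p" "g \<notin> f ` {1..<p}"
    using \<open>f ` {1..<p} \<subseteq> {1..<p}\<close> by fastforce
  have ng: "\<not> p dvd g" using g zdvd_not_zless by force
  have "\<not> QuadRes p g"
  proof
    assume "QuadRes p g"
    then obtain y where y: "[y\<^sup>2 = g] (mod p)" by (auto simp: QuadRes_def)
    have "(y mod p)\<^sup>2 mod p = g"
      using y g by (simp add: cong_def power_mod)
    moreover have "y mod p \<noteq> 0"
      using calculation g(1) by (intro notI) simp
    hence "y mod p \<in> {1..<p}"
      using p(2) pos_mod_bound[of p y] pos_mod_sign[of p y]
      unfolding atLeastLessThan_iff by linarith
    ultimately show False using g(3) by (auto simp: f_def)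
  qed
  hence "Legendre g p = -1" using ng by (simp add: Legendre_def cong_0_iff)
  thus thesis using that[of g] g by simp
qed

lemma exists_Legendre_eq:
  fixes p :: int
  assumes p: "prime p" "2 < p" and e: "e = 1 \<or> e = -1"
  obtains g where "Legendre g p = e"
proof -
  have "Legendre 1 p = 1"
    using Legendre_square[of p 1] not_prime_unit[of p] p(1) by fastforce
  thus thesis using exists_nonresidue[OF p] e that by blast
qed

text \<open>If \<open>r\<close> is the least positive nonresidue, then \<open>r - 1\<close> is a residue \<open>v\<^sup>2\<close>.\<close>

lemma nonresidue_sum:
  fixes p :: int
  assumes p: "prime p" "2 < p"
  obtains v where "\<not> p dvd v" "Legendre (1 + v\<^sup>2) p = -1"
proof -
  obtain g where g: "0 < g" "Legendre g p = -1" using exists_nonresidue[OF p] by blast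
  define r where "r = (LEAST k::nat. Legendre (int k) p = -1)"
  have r: "Legendre (int r) p = -1"
    unfolding r_def by (rule LeastI[of _ "nat g"]) (use g in simp)
  have r1: "Legendre (int r - 1) p \<noteq> -1" "r \<noteq> 0"
  proof -
    show "r \<noteq> 0" using r by (intro notI) (simp add: Legendre_def)
    hence "Legendre (int (r - 1)) p \<noteq> -1"
      using not_less_Least[of "r - 1" "\<lambda>k. Legendre (int k) p = -1"] r_def by simp
    thus "Legendre (int r - 1) p \<noteq> -1" using \<open>r \<noteq> 0\<close> by (simp add: of_nat_diff)
  qed
  have L1: "Legendre 1 p = 1"
    using Legendre_square[of p 1] not_prime_unit[of p] p(1) by fastforce
  have "\<not> p dvd int r - 1"
  proof
    assume "p dvd int r - 1"
    hence "Legendre (int r) p = Legendre 1 p" by (intro Legendre_cong) (simp add: cong_iff_dvd_diff)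
    thus False using L1 r by simp
  qed
  hence n: "\<not> p dvd int r - 1" "Legendre (int r - 1) p = Legendre 1 p"
    using r1 Legendre_cases L1 by metis+
  then obtain v where v: "\<not> p dvd v" "[int r - 1 = 1 * v\<^sup>2] (mod p)"
    using same_Legendre_imp_square_ratio[OF p] by blast
  have "[1 + v\<^sup>2 = int r] (mod p)"
    using cong_sym[OF cong_add[OF cong_refl[of 1] v(2)]] by simp
  hence "Legendre (1 + v\<^sup>2) p = -1" using r Legendre_cong by metis
  thus thesis using that v by blast
qed

text \<open>The numbers 3, 5 and 8 are the differences of the squares 1, 4 and 9 tried in the next
  lemma; 2 also occurs as a factor in the parametrization of a conic.\<close>

lemma prime_ge_7_not_dvd:
  fixes p :: int
  assumes "prime p" "7 \<le> p"
  shows "\<not> p dvd 2" "\<not> p dvd 3" "\<not> p dvd 5" "\<not> p dvd 8"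
proof -
  show "\<not> p dvd 2" "\<not> p dvd 3" "\<not> p dvd 5" 
    using assms(2) zdvd_not_zless[of 2 p] zdvd_not_zless[of 3 p] zdvd_not_zless[of 5 p] by simp_all
  thus "\<not> p dvd 8" using prime_dvd_power[OF assms(1), of 2 3] by fastforce
qed

text \<open>One of \<open>m = 1, 2, 3\<close> works, since the squares \<open>1, 4, 9\<close> are distinct modulo \<open>p \<ge> 7\<close>.\<close>

lemma exists_slope:
  fixes p :: int
  assumes p: "prime p" "7 \<le> p" and b: "\<not> p dvd b"
  obtains m where "\<not> p dvd m" "\<not> p dvd a - b * m\<^sup>2" "\<not> p dvd a + b * m\<^sup>2"
proof (rule ccontr)
  assume "\<not> thesis"
  hence "\<not> p dvd m \<Longrightarrow> p dvd a - b * m\<^sup>2 \<or> p dvd a + b * m\<^sup>2" for m using that by blast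
  from this[of 1] this[of 2] this[of 3]
  have d: "p dvd a - b \<or> p dvd a + b" "p dvd a - b * 4 \<or> p dvd a + b * 4"
    "p dvd a - b * 9 \<or> p dvd a + b * 9"
    using prime_ge_7_not_dvd[OF p] p(1) by (auto simp: not_prime_unit)
  have n: "\<not> p dvd b * 3" "\<not> p dvd b * 5" "\<not> p dvd b * 8"
    using prime_ge_7_not_dvd[OF p] b p(1) by (simp_all add: prime_dvd_mult_iff)
  \<comment> \<open>Two different values of \<open>m\<close> among 1, 2, 3 cannot satisfy the same
    one of the two divisibilities, so these rule out at most two of the three values.\<close>
  have "p dvd a - b \<Longrightarrow> p dvd a - b * 4 \<Longrightarrow> False"
    "p dvd a - b \<Longrightarrow> p dvd a - b * 9 \<Longrightarrow> False"
    "p dvd a - b * 4 \<Longrightarrow> p dvd a - b * 9 \<Longrightarrow> False"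
    using n dvd_diff[of p "a - b" "a - b * 4"] dvd_diff[of p "a - b" "a - b * 9"]
      dvd_diff[of p "a - b * 4" "a - b * 9"] by (auto simp: algebra_simps)
  moreover have "p dvd a + b \<Longrightarrow> p dvd a + b * 4 \<Longrightarrow> False"
    "p dvd a + b \<Longrightarrow> p dvd a + b * 9 \<Longrightarrow> False"
    "p dvd a + b * 4 \<Longrightarrow> p dvd a + b * 9 \<Longrightarrow> False"
    using n dvd_diff[of p "a + b * 4" "a + b"] dvd_diff[of p "a + b * 9" "a + b"]
      dvd_diff[of p "a + b * 9" "a + b * 4"] by (auto simp: algebra_simps)
  ultimately show False using d by blast
qed

text \<open>Here \<open>(s, 0)\<close> with \<open>t = a * s\<^sup>2\<close> is a point of the conic \<open>a * x\<^sup>2 + b * y\<^sup>2 = t\<close>. The lines through it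
  parametrize the conic by \<open>m\<close>, and all but a few \<open>m\<close> give a point off the axes.\<close>

lemma binary_form_represents_class_of_coeff:
  fixes p :: int
  assumes p: "prime p" "7 \<le> p"
    and nz: "\<not> p dvd a" "\<not> p dvd b" "\<not> p dvd t"
    and eq: "Legendre t p = Legendre a p"
  obtains x y where "\<not> p dvd x" "\<not> p dvd y" "[a * x\<^sup>2 + b * y\<^sup>2 = t] (mod p)"
proof -
  have p2: "2 < p" using p by simp
  obtain s where s: "\<not> p dvd s" "[t = a * s\<^sup>2] (mod p)"
    using same_Legendre_imp_square_ratio[OF p(1) p2 nz(3) eq] by blast
  obtain m where m: "\<not> p dvd m" "\<not> p dvd a - b * m\<^sup>2" "\<not> p dvd a + b * m\<^sup>2"
    using exists_slope[OF p nz(2)] by blast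
  obtain w where w: "[(a + b * m\<^sup>2) * w = 1] (mod p)" "\<not> p dvd w"
    using inverse_mod_prime[OF p(1) m(3)] by blast
  \<comment> \<open>Modulo \<open>p\<close> this is the point other than \<open>(-s, 0)\<close> in
    which the line of slope \<open>m\<close> through \<open>(-s, 0)\<close> meets the conic;
    \<open>w\<close> inverts the denominator. It lies on the conic because \<open>(a - b *
    m\<^sup>2)\<^sup>2 + 4 * a * b * m\<^sup>2 = (a + b * m\<^sup>2)\<^sup>2\<close>.\<close>
  define x where "x = s * (a - b * m\<^sup>2) * w"
  define y where "y = 2 * m * a * s * w"
  have "\<not> p dvd x" "\<not> p dvd y"
    using s m w nz p prime_ge_7_not_dvd[OF p] by (simp_all add: x_def y_def prime_dvd_mult_iff)
  moreover have "[a * x\<^sup>2 + b * y\<^sup>2 = t] (mod p)"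
  proof -
    have "a * x\<^sup>2 + b * y\<^sup>2 = (a * s\<^sup>2) * ((a + b * m\<^sup>2) * w)\<^sup>2"
      by (simp add: x_def y_def power2_eq_square algebra_simps)
    also have "[\<dots> = (a * s\<^sup>2) * 1\<^sup>2] (mod p)"
      using w(1) cong_mult cong_refl cong_pow by blast
    finally show ?thesis using s(2) by (simp add: cong_def)
  qed
  ultimately show thesis using that by blast
qed

text \<open>Nonzero elements form two classes, so either \<open>t\<close> shares its class with a
  coefficient, or \<open>a\<close> and \<open>b\<close> share one and \<open>t\<close> has the
  other. In the last case \<open>b\<close> equals \<open>a\<close> up to a square, and a nonresidue
  of the form \<open>1 + v\<^sup>2\<close> leads from the class of \<open>a\<close> to that of
  \<open>t\<close>.\<close>

lemma binary_form_represents: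
  fixes p :: int
  assumes p: "prime p" "7 \<le> p"
    and nz: "\<not> p dvd a" "\<not> p dvd b" "\<not> p dvd t"
  obtains x y where "\<not> p dvd x" "\<not> p dvd y" "[a * x\<^sup>2 + b * y\<^sup>2 = t] (mod p)"
proof -
  have p2: "2 < p" using p by simp
  consider "Legendre t p = Legendre a p" | "Legendre t p = Legendre b p"
    | "Legendre a p = Legendre b p" "Legendre t p = - Legendre a p"
    using Legendre_cases[OF nz(1)] Legendre_cases[OF nz(2)] Legendre_cases[OF nz(3)] by fastforce
  thus thesis
  proof cases
    case 1
    thus ?thesis using binary_form_represents_class_of_coeff[OF p nz] that by blast
  next
    case 2
    obtain y x where "\<not> p dvd y" "\<not> p dvd x" "[b * y\<^sup>2 + a * x\<^sup>2 = t] (mod p)"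
      using binary_form_represents_class_of_coeff[OF p nz(2,1,3) 2] by blast
    thus ?thesis using that[of x y] by (simp add: add.commute)
  next
    case 3
    obtain v where v: "\<not> p dvd v" "Legendre (1 + v\<^sup>2) p = -1"
      using nonresidue_sum[OF p(1) p2] by blast
    have "Legendre t p = Legendre (a * (1 + v\<^sup>2)) p"
      using 3 v Legendre_mult[OF p(1) p2] by simp
    then obtain u where u: "\<not> p dvd u" "[t = a * (1 + v\<^sup>2) * u\<^sup>2] (mod p)"
      using same_Legendre_imp_square_ratio[OF p(1) p2 nz(3)] by blast
    obtain z where z: "\<not> p dvd z" "[a = b * z\<^sup>2] (mod p)"
      using same_Legendre_imp_square_ratio[OF p(1) p2 nz(1) 3(1)] by blast
    have "\<not> p dvd z * v * u" using z v u p by (simp add: prime_dvd_mult_iff)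
    moreover have "[a * u\<^sup>2 + b * (z * v * u)\<^sup>2 = t] (mod p)"
    proof -
      have "[a * u\<^sup>2 + (b * z\<^sup>2) * (v\<^sup>2 * u\<^sup>2) = a * u\<^sup>2 + a * (v\<^sup>2 * u\<^sup>2)] (mod p)"
        by (intro cong_add cong_mult cong_refl cong_sym[OF z(2)])
      moreover have "a * u\<^sup>2 + a * (v\<^sup>2 * u\<^sup>2) = a * (1 + v\<^sup>2) * u\<^sup>2"
        by (simp add: algebra_simps)
      ultimately show ?thesis
        using u(2) by (simp add: power_mult_distrib mult.assoc cong_def)
    qed
    ultimately show ?thesis using that u by blast
  qed
qed

section \<open>Weights with prescribed Legendre symbols\<close>

text \<open>Weights of a given symbol arise as a fixed element of that symbol times a square. Once
  the third weight is fixed, a binary form in the other two has to represent a value that is nonzero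
  modulo \<open>p\<close>. The constant \<open>s\<close> stands for the remaining terms of a longer
  sum.\<close>

lemma ternary_weights:
  fixes p :: int
  assumes p: "prime p" "7 \<le> p" and nz: "\<not> p dvd a" "\<not> p dvd b" "\<not> p dvd c"
    and e: "e1 = 1 \<or> e1 = -1" "e2 = 1 \<or> e2 = -1" "e3 = 1 \<or> e3 = -1"
  obtains u v w where "Legendre u p = e1" "Legendre v p = e2" "Legendre w p = e3"
    "[u * a + v * b + w * c + s = 0] (mod p)"
proof -
  have p2: "2 < p" using p by simp
  obtain g1 where g1: "Legendre g1 p = e1" using exists_Legendre_eq[OF p(1) p2 e(1)] by blast
  obtain g2 where g2: "Legendre g2 p = e2" using exists_Legendre_eq[OF p(1) p2 e(2)] by blast
  obtain g3 where g3: "Legendre g3 p = e3" using exists_Legendre_eq[OF p(1) p2 e(3)] by blast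
  have gnz: "\<not> p dvd g1" "\<not> p dvd g2" "\<not> p dvd g3"
    using g1 g2 g3 e Legendre_eq_0_iff[of g1 p] Legendre_eq_0_iff[of g2 p]
      Legendre_eq_0_iff[of g3 p] by auto
  \<comment> \<open>If both \<open>z = 1\<close> and \<open>z = 2\<close> failed, \<open>p\<close>
    would divide the difference \<open>3 * g3 * c\<close>.\<close>
  obtain z where z: "\<not> p dvd z" "\<not> p dvd s + g3 * c * z\<^sup>2"
  proof (rule ccontr)
    assume "\<not> thesis"
    hence "p dvd s + g3 * c * 1\<^sup>2" "p dvd s + g3 * c * 2\<^sup>2"
      using that[of 1] that[of 2] prime_ge_7_not_dvd[OF p] not_prime_unit[of p] p(1) by blast+
    hence "p dvd (s + g3 * c * 2\<^sup>2) - (s + g3 * c * 1\<^sup>2)" by (rule dvd_diff[rotated])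
    hence "p dvd g3 * c * 3" by (simp add: algebra_simps)
    thus False using gnz nz prime_ge_7_not_dvd[OF p] p(1) by (simp add: prime_dvd_mult_iff)
  qed
  have "\<not> p dvd g1 * a" "\<not> p dvd g2 * b" "\<not> p dvd - (s + g3 * c * z\<^sup>2)"
    using gnz nz z p(1) by (simp_all add: prime_dvd_mult_iff del: minus_add_distrib)
  then obtain x y where xy: "\<not> p dvd x" "\<not> p dvd y"
    "[g1 * a * x\<^sup>2 + g2 * b * y\<^sup>2 = - (s + g3 * c * z\<^sup>2)] (mod p)"
    using binary_form_represents[OF p] by blast
  show thesis
  proof
    show "Legendre (g1 * x\<^sup>2) p = e1" "Legendre (g2 * y\<^sup>2) p = e2" "Legendre (g3 * z\<^sup>2) p = e3"
      using g1 g2 g3 xy z p(1)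
      by (simp_all add: Legendre_mult[OF p(1) p2] Legendre_square)
    show "[g1 * x\<^sup>2 * a + g2 * y\<^sup>2 * b + g3 * z\<^sup>2 * c + s = 0] (mod p)"
      using xy(3) by (simp add: cong_iff_dvd_diff algebra_simps)
  qed
qed

text \<open>Only the terms in \<open>K\<close> matter modulo \<open>p\<close>. Three of them can
  absorb whatever the other terms contribute; two of them cancel only if \<open>w i * w j\<close>
  has the symbol of \<open>- (x i * x j)\<close>, which is what \<open>c2\<close> demands of the
  signs.\<close>

lemma signed_weights:
  fixes p :: int and x e :: "'a \<Rightarrow> int"
  assumes p: "prime p" "7 \<le> p" and fin: "finite I"
    and e: "\<And>i. e i = 1 \<or> e i = -1"
    and K: "K = {i \<in> I. \<not> p dvd x i}" and c1: "card K \<noteq> 1"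
    and c2: "card K = 2 \<Longrightarrow> (\<Prod>i\<in>K. e i) = Legendre (- (\<Prod>i\<in>K. x i)) p"
  obtains w where "\<And>i. Legendre (w i) p = e i" "[(\<Sum>i\<in>I. w i * x i) = 0] (mod p)"
proof -
  have p2: "2 < p" using p by simp
  have "\<exists>y. Legendre y p = e i" for i
    using exists_Legendre_eq[OF p(1) p2 e] by metis
  then obtain g where g: "\<And>i. Legendre (g i) p = e i" by metis
  have finK: "finite K" "K \<subseteq> I" using fin by (auto simp: K)
  consider "card K = 0" | "card K = 2" | "3 \<le> card K" using c1 by linarith
  thus thesis
  proof cases
    case 1
    hence "p dvd x i" if "i \<in> I" for i using that finK K by auto
    hence "[(\<Sum>i\<in>I. g i * x i) = 0] (mod p)" by (simp add: cong_0_iff dvd_sum)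
    thus ?thesis using that g by blast
  next
    case 2
    then obtain i j where ij: "K = {i, j}" "i \<noteq> j" by (auto simp: card_2_iff)
    have eij: "e i * e j = Legendre (- (x i * x j)) p" using c2[OF 2] ij by simp
    have nz: "\<not> p dvd x i" "\<not> p dvd x j" and I: "{i, j} \<subseteq> I" using ij K by auto
    obtain b where b: "[x j * b = 1] (mod p)" "\<not> p dvd b"
      using inverse_mod_prime[OF p(1) nz(2)] by blast
    \<comment> \<open>As \<open>b\<close> inverts \<open>x j\<close>, this is
      \<open>- g i * x i / x j\<close> modulo \<open>p\<close>, the weight that cancels the term at
      \<open>i\<close>; the square \<open>b\<^sup>2\<close> makes its symbol easy to read
      off.\<close>
    define v where "v = g i * (- (x i * x j)) * b\<^sup>2"
    define w where "w = g(j := v)"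
    have "Legendre v p = e i * Legendre (- (x i * x j)) p * 1"
      unfolding v_def Legendre_mult[OF p(1) p2] g Legendre_square[OF b(2) p(1)] ..
    also have "\<dots> = e j" using e[of i] eij by auto
    finally have "Legendre (w k) p = e k" for k using g by (simp add: w_def)
    moreover have "[(\<Sum>k\<in>I. w k * x k) = 0] (mod p)"
    proof -
      have "v * x j + g i * x i = - (g i * x i) * ((x j * b)\<^sup>2 - 1\<^sup>2)"
        by (simp add: v_def power2_eq_square algebra_simps)
      moreover have "p dvd (x j * b)\<^sup>2 - 1\<^sup>2"
        using cong_pow[OF b(1), of 2] by (simp only: cong_iff_dvd_diff)
      ultimately have "p dvd v * x j + g i * x i" by simp
      moreover have "p dvd (\<Sum>k\<in>I - {i, j}. w k * x k)"
      proof (rule dvd_sum)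
        fix k assume "k \<in> I - {i, j}"
        hence "p dvd x k" using ij(1) K by blast
        thus "p dvd w k * x k" by simp
      qed
      moreover have "(\<Sum>k\<in>I. w k * x k) = (\<Sum>k\<in>I - {i, j}. w k * x k) + (v * x j + g i * x i)"
        using sum.subset_diff[OF I fin, of "\<lambda>k. w k * x k"] ij(2) by (simp add: w_def)
      ultimately show ?thesis by (simp add: cong_0_iff)
    qed
    ultimately show ?thesis using that by blast
  next
    case 3
    then obtain T where "T \<subseteq> K" "card T = 3" using obtain_subset_with_card_n[of 3 K] by blast
    then obtain a b c where abc: "{a, b, c} \<subseteq> K" "a \<noteq> b" "a \<noteq> c" "b \<noteq> c"
      by (auto simp: card_3_iff)
    have I: "{a, b, c} \<subseteq> I" using abc(1) finK(2) by (rule subset_trans)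
    have nz: "\<not> p dvd x a" "\<not> p dvd x b" "\<not> p dvd x c" using abc(1) K by auto
    obtain u v t where uvt: "Legendre u p = e a" "Legendre v p = e b" "Legendre t p = e c"
      "[u * x a + v * x b + t * x c + (\<Sum>k\<in>I - {a, b, c}. g k * x k) = 0] (mod p)"
      using ternary_weights[OF p nz e e e] by blast
    define w where "w = g(a := u, b := v, c := t)"
    have "Legendre (w k) p = e k" for k using g uvt by (simp add: w_def)
    moreover have "(\<Sum>k\<in>I. w k * x k) =
        u * x a + v * x b + t * x c + (\<Sum>k\<in>I - {a, b, c}. g k * x k)"
      using sum.subset_diff[OF I fin, of "\<lambda>k. w k * x k"] abc
      by (simp add: w_def)
    ultimately show ?thesis using that uvt(4) by metis
  qed
qed

text \<open>Two distinct sets of size two each contain an index outside the other, and the sign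
  there sets one product without affecting the other. A set of another size imposes no
  condition.\<close>

lemma sign_choice:
  fixes s t :: int
  assumes st: "s = 1 \<or> s = -1" "t = 1 \<or> t = -1"
    and neq: "\<not> (P = Q \<and> card P = 2)"
  obtains e :: "'a \<Rightarrow> int" where "\<And>i. e i = 1 \<or> e i = -1"
    "card P = 2 \<Longrightarrow> (\<Prod>i\<in>P. e i) = s" "card Q = 2 \<Longrightarrow> (\<Prod>i\<in>Q. e i) = t"
proof -
  have *: "\<exists>j. card A = 2 \<longrightarrow> j \<in> A \<and> (card B = 2 \<longrightarrow> j \<notin> B)"
    if "\<not> (A = B \<and> card A = 2)" for A B :: "'a set"
  proof (cases "card A = 2 \<and> card B = 2")
    case True
    hence "\<not> A \<subseteq> B" using that card_subset_eq[of B A] card.infinite[of B] by fastforce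
    thus ?thesis by blast
  next
    case False
    thus ?thesis by (metis card.empty ex_in_conv zero_neq_numeral)
  qed
  obtain j where j: "card P = 2 \<longrightarrow> j \<in> P \<and> (card Q = 2 \<longrightarrow> j \<notin> Q)" using *[OF neq] by blast
  obtain l where l: "card Q = 2 \<longrightarrow> l \<in> Q \<and> (card P = 2 \<longrightarrow> l \<notin> P)" using *[of Q P] neq by blast
  \<comment> \<open>All signs are 1 except possibly at \<open>j\<close> and \<open>l\<close>. The
    guards on the cardinalities disregard an index whose set imposes no condition, since it is then
    arbitrary.\<close>
  define e where "e = (\<lambda>i. if card P = 2 \<and> i = j then s else if card Q = 2 \<and> i = l then t else 1)"
  show thesis
  proof
    show "e i = 1 \<or> e i = -1" for i using st by (simp add: e_def)
    show "(\<Prod>i\<in>P. e i) = s" if "card P = 2"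
    proof -
      have "(\<Prod>i\<in>P. e i) = (\<Prod>i\<in>P. if i = j then s else 1)"
        using that l by (intro prod.cong) (auto simp: e_def)
      thus ?thesis using that j card.infinite[of P] by (cases "finite P") auto
    qed
    show "(\<Prod>i\<in>Q. e i) = t" if "card Q = 2"
    proof -
      have "(\<Prod>i\<in>Q. e i) = (\<Prod>i\<in>Q. if i = l then t else 1)"
        using that j by (intro prod.cong) (auto simp: e_def)
      thus ?thesis using that l card.infinite[of Q] by (cases "finite Q") auto
    qed
  qed
qed

text \<open>This serves the distinguished prime, where the symbols of the weights are free: the
  signs are chosen to suit the pair condition, with \<open>{}\<close> as the second set in
  \<open>sign_choice\<close>.\<close>

lemma unit_weights:
  fixes p :: int and x :: "'a \<Rightarrow> int"
  assumes p: "prime p" "7 \<le> p" and fin: "finite I"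
    and c1: "card {i \<in> I. \<not> p dvd x i} \<noteq> 1"
  obtains w where "\<And>i. \<not> p dvd w i" "[(\<Sum>i\<in>I. w i * x i) = 0] (mod p)"
proof -
  let ?K = "{i \<in> I. \<not> p dvd x i}"
  have "\<not> p dvd - (\<Prod>i\<in>?K. x i)" using p(1) fin by (simp add: prime_dvd_prod_iff)
  hence s: "Legendre (- (\<Prod>i\<in>?K. x i)) p = 1 \<or> Legendre (- (\<Prod>i\<in>?K. x i)) p = -1"
    by (rule Legendre_cases)
  have neq: "\<not> (?K = {} \<and> card ?K = 2)" by (metis card.empty zero_neq_numeral)
  obtain e :: "'a \<Rightarrow> int" where e: "\<And>i. e i = 1 \<or> e i = -1"
    "card ?K = 2 \<Longrightarrow> (\<Prod>i\<in>?K. e i) = Legendre (- (\<Prod>i\<in>?K. x i)) p"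
    using sign_choice[OF s disjI1[OF refl] neq] by blast
  obtain w where w: "\<And>i. Legendre (w i) p = e i" "[(\<Sum>i\<in>I. w i * x i) = 0] (mod p)"
    using signed_weights[OF p fin e(1) refl c1 e(2)] by blast
  have "\<not> p dvd w i" for i using w(1)[of i] e(1)[of i] Legendre_eq_0_iff[of "w i" p] by auto
  thus thesis using that w(2) by blast
qed

text \<open>A single sign function \<open>e\<close> prescribes the symbols at both primes, so that
  they agree. The two pair conditions on \<open>e\<close> could conflict only on a common pair,
  which \<open>neq\<close> excludes.\<close>

lemma coupled_weights:
  fixes p q :: int and x :: "'a \<Rightarrow> int"
  assumes p: "prime p" "7 \<le> p" and q: "prime q" "7 \<le> q" and fin: "finite I"
    and cp: "card {i \<in> I. \<not> p dvd x i} \<noteq> 1" and cq: "card {i \<in> I. \<not> q dvd x i} \<noteq> 1"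
    and neq: "\<not> ({i \<in> I. \<not> p dvd x i} = {i \<in> I. \<not> q dvd x i} \<and> card {i \<in> I. \<not> p dvd x i} = 2)"
  obtains u v where "[(\<Sum>i\<in>I. u i * x i) = 0] (mod p)" "[(\<Sum>i\<in>I. v i * x i) = 0] (mod q)"
    "\<And>i. Legendre (u i) p = Legendre (v i) q" "\<And>i. Legendre (u i) p \<noteq> 0"
proof -
  let ?P = "{i \<in> I. \<not> p dvd x i}" and ?Q = "{i \<in> I. \<not> q dvd x i}"
  have "\<not> p dvd - (\<Prod>i\<in>?P. x i)" "\<not> q dvd - (\<Prod>i\<in>?Q. x i)"
    using p(1) q(1) fin by (simp_all add: prime_dvd_prod_iff)
  hence s: "Legendre (- (\<Prod>i\<in>?P. x i)) p = 1 \<or> Legendre (- (\<Prod>i\<in>?P. x i)) p = -1"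
    "Legendre (- (\<Prod>i\<in>?Q. x i)) q = 1 \<or> Legendre (- (\<Prod>i\<in>?Q. x i)) q = -1"
    by (blast dest: Legendre_cases)+
  then obtain e :: "'a \<Rightarrow> int" where e: "\<And>i. e i = 1 \<or> e i = -1"
    "card ?P = 2 \<Longrightarrow> (\<Prod>i\<in>?P. e i) = Legendre (- (\<Prod>i\<in>?P. x i)) p"
    "card ?Q = 2 \<Longrightarrow> (\<Prod>i\<in>?Q. e i) = Legendre (- (\<Prod>i\<in>?Q. x i)) q"
    using sign_choice[OF s neq] by blast
  obtain u where u: "\<And>i. Legendre (u i) p = e i" "[(\<Sum>i\<in>I. u i * x i) = 0] (mod p)"
    using signed_weights[OF p fin e(1) refl cp e(2)] by blast
  obtain v where v: "\<And>i. Legendre (v i) q = e i" "[(\<Sum>i\<in>I. v i * x i) = 0] (mod q)"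
    using signed_weights[OF q fin e(1) refl cq e(3)] by blast
  have "Legendre (u i) p \<noteq> 0" for i using u(1)[of i] e(1)[of i] by auto
  thus thesis using that[of u v] u v by simp
qed

section \<open>Choosing the support\<close>

lemma subset_avoiding_one:
  assumes "finite X" "2 \<le> card X"
  obtains I where "I \<subseteq> X" "I \<noteq> {}" "card (I \<inter> P) \<noteq> 1"
proof (cases "card (X \<inter> P) = 1")
  case False
  moreover have "X \<noteq> {}" using assms by auto
  ultimately show ?thesis using that[of X] by auto
next
  case True
  hence "X \<noteq> X \<inter> P" using assms(2) by auto
  hence "X - P \<noteq> {}" by blast
  thus ?thesis using that[of "X - P"] by (simp add: Int_commute Diff_Int_distrib)
qed

lemma card_Diff_ge:
  assumes "finite X" "card (X \<inter> P) \<le> k" "k + m \<le> card X"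
  shows "m \<le> card (X - P)"
  using card_Diff_subset_Int[of X P] assms by simp

text \<open>A set met in a single index is removed, leaving at least two indices for the other set;
  a common pair is removed as a whole, leaving an index outside both sets; otherwise
  \<open>X\<close> itself works.\<close>

lemma subset_avoiding_two:
  assumes fin: "finite X" and c: "3 \<le> card X"
  obtains I where "I \<subseteq> X" "I \<noteq> {}" "card (I \<inter> P) \<noteq> 1" "card (I \<inter> Q) \<noteq> 1"
    "\<not> (I \<inter> P = I \<inter> Q \<and> card (I \<inter> P) = 2)"
proof -
  note found = that
  \<comment> \<open>Here \<open>P\<close> and \<open>Q\<close> are interchangeable. Since
    \<open>I\<close> misses \<open>A\<close>, the two intersections cannot be the same pair.\<close>
  have rem: thesis
    if A: "card (X \<inter> A) = 1" and AB: "{A, B} = {P, Q}" for A B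
  proof -
    have "2 \<le> card (X - A)" using card_Diff_ge[of X A 1 2] A c fin by simp
    then obtain I where I: "I \<subseteq> X - A" "I \<noteq> {}" "card (I \<inter> B) \<noteq> 1"
      using subset_avoiding_one[of "X - A" B] fin by blast
    moreover have "I \<inter> A = {}" "I \<subseteq> X" using I(1) by blast+
    ultimately show thesis using found[of I] AB by (auto simp: doubleton_eq_iff)
  qed
  show thesis
  proof (cases "X \<inter> P = X \<inter> Q \<and> card (X \<inter> P) = 2")
    case True
    hence "card (X \<inter> P) = 2" by blast
    hence "1 \<le> card (X - P)" using card_Diff_ge[of X P 2 1] c fin by simp
    hence "X - P \<noteq> {}" by (metis card.empty not_one_le_zero)
    moreover have "(X - P) \<inter> P = {}" "(X - P) \<inter> Q = {}" using True by blast+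
    ultimately show thesis using that[of "X - P"] by auto
  next
    case False
    have "X \<noteq> {}" using c by auto
    thus thesis using rem[of P Q] rem[of Q P] that[of X] False by (auto simp: insert_commute)
  qed
qed

text \<open>Removing a set met only once leaves three indices and the problem for two sets; removing
  a common pair of \<open>P\<close> and \<open>Q\<close> leaves two indices and only
  \<open>R\<close> to avoid. The asymmetry reflects that \<open>P\<close> and \<open>Q\<close>
  belong to the coupled primes and \<open>R\<close> to the distinguished one.\<close>

lemma subset_avoiding_three:
  assumes fin: "finite X" and c: "4 \<le> card X"
  obtains I where "I \<subseteq> X" "I \<noteq> {}"
    "card (I \<inter> P) \<noteq> 1" "card (I \<inter> Q) \<noteq> 1" "card (I \<inter> R) \<noteq> 1"
    "\<not> (I \<inter> P = I \<inter> Q \<and> card (I \<inter> P) = 2)"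
proof -
  note found = that
  have rem: thesis
    if A: "card (X \<inter> A) = 1" and AB: "{A, B} = {P, Q}" for A B
  proof -
    have "3 \<le> card (X - A)" using card_Diff_ge[of X A 1 3] A c fin by simp
    then obtain I where I: "I \<subseteq> X - A" "I \<noteq> {}" "card (I \<inter> B) \<noteq> 1" "card (I \<inter> R) \<noteq> 1"
      using subset_avoiding_two[of "X - A" B R] fin by blast
    moreover have "I \<inter> A = {}" "I \<subseteq> X" using I(1) by blast+
    ultimately show thesis using found[of I] AB by (auto simp: doubleton_eq_iff)
  qed
  consider "card (X \<inter> R) = 1" | "X \<inter> P = X \<inter> Q \<and> card (X \<inter> P) = 2" | "card (X \<inter> P) = 1"
    | "card (X \<inter> Q) = 1" | "card (X \<inter> R) \<noteq> 1" "\<not> (X \<inter> P = X \<inter> Q \<and> card (X \<inter> P) = 2)"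
      "card (X \<inter> P) \<noteq> 1" "card (X \<inter> Q) \<noteq> 1" by blast
  thus thesis
  proof cases
    case 1
    hence "3 \<le> card (X - R)" using card_Diff_ge[of X R 1 3] c fin by simp
    then obtain I where I: "I \<subseteq> X - R" "I \<noteq> {}" "card (I \<inter> P) \<noteq> 1" "card (I \<inter> Q) \<noteq> 1"
        "\<not> (I \<inter> P = I \<inter> Q \<and> card (I \<inter> P) = 2)"
      using subset_avoiding_two[of "X - R" P Q] fin by blast
    moreover have "I \<inter> R = {}" using I(1) by blast
    ultimately show thesis using that[of I] by auto
  next
    case 2
    hence "card (X \<inter> P) = 2" by blast
    hence "2 \<le> card (X - P)" using card_Diff_ge[of X P 2 2] c fin by simp
    then obtain I where I: "I \<subseteq> X - P" "I \<noteq> {}" "card (I \<inter> R) \<noteq> 1"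
      using subset_avoiding_one[of "X - P" R] fin by blast
    moreover have "I \<inter> P = {}" "I \<inter> Q = {}" using I(1) 2 by blast+
    ultimately show thesis using that[of I] by auto
  next
    case 3
    thus thesis using rem[of P Q] by simp
  next
    case 4
    thus thesis using rem[of Q P] by (simp add: insert_commute)
  next
    case 5
    moreover have "X \<noteq> {}" using c by auto
    ultimately show thesis using that[of X] by auto
  qed
qed

section \<open>The weight groups\<close>

lemma jacobi_sym_prime_mult:
  assumes "prime p" "\<not> p dvd m" "m \<noteq> 0"
  shows "jacobi_sym a (p * m) = Legendre a p * jacobi_sym a m"
proof -
  have p: "p \<noteq> 0" "\<not> is_unit p" using assms(1) by auto
  have "prime_factors (p * m) = insert p (prime_factors m)"
    using assms p by (simp add: prime_factors_product prime_factorization_prime)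
  moreover have "p \<notin> prime_factors m" using assms(2) by auto
  moreover have "multiplicity p (p * m) = 1"
    using assms p by (simp add: multiplicity_times_same not_dvd_imp_multiplicity_0)
  moreover have "multiplicity q (p * m) = multiplicity q m" if "q \<in> prime_factors m" for q
  proof -
    have q: "prime q" "q dvd m" using that by auto
    hence "\<not> q dvd p" using assms by (metis primes_dvd_imp_eq)
    thus ?thesis using assms(3) p
        prime_elem_multiplicity_mult_distrib[OF prime_imp_prime_elem[OF q(1)], of p m]
      by (simp add: not_dvd_imp_multiplicity_0)
  qed
  ultimately show ?thesis by (simp add: jacobi_sym_def)
qed

lemma jacobi_sym_prime:
  assumes "prime p"
  shows "jacobi_sym a p = Legendre a p"
proof -
  have "\<not> p dvd 1" using assms not_prime_unit by blast
  hence "jacobi_sym a (p * 1) = Legendre a p * jacobi_sym a 1"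
    using assms by (intro jacobi_sym_prime_mult) simp_all
  moreover have "jacobi_sym a 1 = 1" by (simp add: jacobi_sym_def)
  ultimately show ?thesis by simp
qed

lemma jacobi_sym_cong:
  assumes "[a = b] (mod k)" "m dvd k"
  shows "jacobi_sym a m = jacobi_sym b m"
  unfolding jacobi_sym_def
proof (rule prod.cong[OF refl])
  fix p assume "p \<in> prime_factors m"
  hence "p dvd k" using assms(2) by (auto intro: dvd_trans)
  hence "[a = b] (mod p)" using assms(1) cong_dvd_modulus by blast
  thus "Legendre a p ^ multiplicity p m = Legendre b p ^ multiplicity p m"
    using Legendre_cong by metis
qed

lemma jacobi_sym_mult:
  assumes "odd m"
  shows "jacobi_sym (a * b) m = jacobi_sym a m * jacobi_sym b m"
proof -
  have "Legendre (a * b) p = Legendre a p * Legendre b p" if "p \<in> prime_factors m" for p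
  proof -
    have p: "prime p" "p dvd m" using that by auto
    hence "p \<noteq> 2" using assms by auto
    hence "2 < p" using prime_ge_2_int[OF p(1)] by simp
    thus ?thesis using Legendre_mult[OF p(1)] by simp
  qed
  thus ?thesis
    by (simp add: jacobi_sym_def prod.distrib[symmetric] power_mult_distrib cong: prod.cong)
qed

lemma jacobi_sym_1: "jacobi_sym 1 m = 1"
proof -
  have "Legendre 1 p = 1" if "p \<in> prime_factors m" for p
    using that Legendre_square[of p 1] not_prime_unit[of p] by fastforce
  thus ?thesis by (simp add: jacobi_sym_def)
qed

text \<open>The symbol modulo \<open>n\<close> is the one modulo \<open>n div r\<close> times
  \<open>Legendre a r\<close>, which is nonzero on units and cancels. Membership thus restricts a
  unit only through its symbol modulo \<open>n div r\<close>.\<close>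

lemma L_grp_eq:
  assumes "prime r" "r dvd n" "\<not> r dvd n div r" "n > 0"
  shows "L_grp n r = {a \<in> units_mod n. jacobi_sym a (n div r) = 1}"
proof -
  have n: "n = r * (n div r)" "n div r \<noteq> 0" using assms by auto
  have "jacobi_sym a n = Legendre a r * jacobi_sym a (n div r)" for a
    using jacobi_sym_prime_mult[OF assms(1,3) n(2), of a] n(1) by metis
  moreover have "Legendre a r \<noteq> 0" if "a \<in> units_mod n" for a
    using that assms(1,2) not_coprimeI[of r a n] not_prime_unit[of r]
    by (auto simp: units_mod_def Legendre_eq_0_iff)
  ultimately show ?thesis by (auto simp: L_grp_def)
qed

lemma units_mod_reduce:
  assumes "a \<in> units_mod n" "m dvd n" "m > 0"
  shows "a mod m \<in> units_mod m"
  using assms coprime_divisors[of a a m n] by (simp add: units_mod_def coprime_mod_left_iff)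

lemma units_mod_mult:
  assumes "a \<in> units_mod n" "b \<in> units_mod n"
  shows "a * b mod n \<in> units_mod n"
proof -
  have "n > 0" using assms by (auto simp: units_mod_def)
  thus ?thesis using assms by (simp add: units_mod_def coprime_mod_left_iff)
qed

lemma L_grp_reduce:
  assumes "prime r" "r dvd n" "\<not> r dvd n div r" "n > 0" "a \<in> L_grp n r"
  shows "a mod (n div r) \<in> S_grp (n div r)"
proof -
  have d: "n div r dvd n" "n div r > 0" using assms
    by (auto simp: pos_imp_zdiv_pos_iff zdvd_imp_le prime_gt_0_int)
  thus ?thesis
    using assms(5) units_mod_reduce[OF _ d, of a]
      jacobi_sym_cong[of "a mod (n div r)" a "n div r" "n div r"]
    by (simp add: L_grp_eq[OF assms(1-4)] S_grp_def)
qed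

lemma L_grp_mult:
  assumes "prime r" "r dvd n" "\<not> r dvd n div r" "n > 0" "odd n"
    and "a \<in> L_grp n r" "b \<in> L_grp n r"
  shows "a * b mod n \<in> L_grp n r"
proof -
  have d: "n div r dvd n" using assms by auto
  hence o: "odd (n div r)" using assms(5) dvd_trans by blast
  show ?thesis
    using assms(6,7) units_mod_mult jacobi_sym_cong[OF _ d, of "a * b mod n" "a * b"]
    by (simp add: L_grp_eq[OF assms(1-4)] jacobi_sym_mult[OF o])
qed

lemma L_grp_inverse:
  assumes "prime r" "r dvd n" "\<not> r dvd n div r" "n > 0" "odd n" "a \<in> L_grp n r"
  obtains b where "b \<in> L_grp n r" "[a * b = 1] (mod n)"
proof -
  have d: "n div r dvd n" using assms by auto
  hence o: "odd (n div r)" using assms(5) dvd_trans by blast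
  have a: "coprime a n" "jacobi_sym a (n div r) = 1"
    using assms(6) by (auto simp: L_grp_eq[OF assms(1-4)] units_mod_def)
  obtain b where b: "0 \<le> b" "b < n" "[a * b = 1] (mod n)"
    using a(1) coprime_iff_invertible'_int[OF assms(4)] by blast
  have "coprime b n" using b(3) by (metis coprime_iff_invertible_int mult.commute)
  moreover have "jacobi_sym b (n div r) = 1"
    using jacobi_sym_cong[OF b(3) d] a(2) by (simp add: jacobi_sym_mult[OF o] jacobi_sym_1)
  ultimately show thesis
    using that[of b] b by (simp add: L_grp_eq[OF assms(1-4)] units_mod_def)
qed

section \<open>Weighted zero-sums\<close>

text \<open>If the term at \<open>\<sigma> i\<close> is \<open>c * a i\<close> times the term at
  \<open>i\<close>, the weight \<open>w i / a i\<close> turns the sum into \<open>c\<close> times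
  the old one; closure of \<open>A\<close> under products and inverses keeps this weight in
  \<open>A\<close>.\<close>

lemma has_wzs_equiv:
  assumes eq: "equiv_wrt n A xs ys" and wzs: "has_wzs n A xs"
    and mult: "\<And>a b. a \<in> A \<Longrightarrow> b \<in> A \<Longrightarrow> a * b mod n \<in> A"
    and inverse: "\<And>a. a \<in> A \<Longrightarrow> \<exists>b\<in>A. [a * b = 1] (mod n)"
  shows "has_wzs n A ys"
proof -
  obtain I w where I: "I \<subseteq> {..<length xs}" "I \<noteq> {}" and w: "\<And>i. i \<in> I \<Longrightarrow> w i \<in> A"
    and sum0: "[(\<Sum>i\<in>I. w i * xs ! i) = 0] (mod n)"
    using wzs by (auto simp: has_wzs_def)
  obtain a c \<sigma> where a: "\<And>i. i < length xs \<Longrightarrow> a i \<in> A" and \<sigma>: "\<sigma> permutes {..<length xs}"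
    and ys: "\<And>i. i < length xs \<Longrightarrow> [ys ! (\<sigma> i) = c * a i * xs ! i] (mod n)"
    and len: "length xs = length ys"
    using eq unfolding equiv_wrt_def by blast
  have "\<exists>b. i < length xs \<longrightarrow> b \<in> A \<and> [a i * b = 1] (mod n)" for i
    using a inverse by blast
  then obtain b where b: "\<And>i. i < length xs \<Longrightarrow> b i \<in> A \<and> [a i * b i = 1] (mod n)"
    by metis
  have inj: "inj \<sigma>" using \<sigma> by (rule permutes_inj)
  define w' where "w' = (\<lambda>j. w (inv_into UNIV \<sigma> j) * b (inv_into UNIV \<sigma> j) mod n)"
  have w': "w' (\<sigma> i) = w i * b i mod n" for i
    using inj by (simp add: w'_def)
  have "(\<Sum>j\<in>\<sigma> ` I. w' j * ys ! j) = (\<Sum>i\<in>I. w' (\<sigma> i) * ys ! (\<sigma> i))"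
    using inj by (simp add: sum.reindex inj_on_subset)
  also have "[\<dots> = (\<Sum>i\<in>I. c * (w i * xs ! i))] (mod n)"
  proof (rule cong_sum)
    fix i assume "i \<in> I"
    hence i: "i < length xs" using I by auto
    have "[w' (\<sigma> i) * ys ! (\<sigma> i) = (w i * b i) * (c * a i * xs ! i)] (mod n)"
      using ys[OF i] by (intro cong_mult) (simp_all add: w')
    also have "(w i * b i) * (c * a i * xs ! i) = (a i * b i) * (c * (w i * xs ! i))"
      by (simp add: algebra_simps)
    also have "[(a i * b i) * (c * (w i * xs ! i)) = 1 * (c * (w i * xs ! i))] (mod n)"
      using b[OF i] by (intro cong_mult) simp_all
    finally show "[w' (\<sigma> i) * ys ! (\<sigma> i) = c * (w i * xs ! i)] (mod n)" by simp
  qed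
  also have "(\<Sum>i\<in>I. c * (w i * xs ! i)) = c * (\<Sum>i\<in>I. w i * xs ! i)"
    by (simp add: sum_distrib_left)
  also have "[\<dots> = c * 0] (mod n)" using sum0 by (intro cong_mult) simp_all
  finally have "[(\<Sum>j\<in>\<sigma> ` I. w' j * ys ! j) = 0] (mod n)" by simp
  moreover have "\<sigma> ` I \<subseteq> {..<length ys}"
    using image_mono[OF I(1), of \<sigma>] permutes_image[OF \<sigma>] len by simp
  moreover have "\<forall>j\<in>\<sigma> ` I. w' j \<in> A" 
  proof (intro ballI, elim imageE)
    fix i j assume "i \<in> I" "j = \<sigma> i"
    thus "w' j \<in> A" using w[of i] b[of i] I(1) mult[of "w i" "b i"] by (auto simp: w')
  qed
  ultimately show ?thesis using I(2) unfolding has_wzs_def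
    by (intro exI[of _ "\<sigma> ` I"] exI[of _ w']) simp
qed

text \<open>The map \<open>f\<close> places the short sequence inside the long one: it is
  \<open>id\<close> for form (i) and \<open>Suc\<close> for form (ii). Terms outside its image
  vanish modulo \<open>m\<close>, so restricting the sum to the image leaves a zero-sum, and
  \<open>ne\<close> keeps it nonempty.\<close>

lemma has_wzs_reduce:
  assumes "m dvd n" and fin: "finite I" and sum0: "[(\<Sum>i\<in>I. w i * ys ! i) = 0] (mod n)"
    and w: "\<And>i. i \<in> I \<Longrightarrow> w i mod m \<in> B"
    and f: "inj f" "\<And>j. j < length zs \<Longrightarrow> zs ! j = ys ! f j mod m"
    and zero: "\<And>i. i \<in> I \<Longrightarrow> i \<notin> f ` {..<length zs} \<Longrightarrow> m dvd ys ! i"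
    and ne: "I \<inter> f ` {..<length zs} \<noteq> {}"
  shows "has_wzs m B zs"
proof -
  define J where "J = {j \<in> {..<length zs}. f j \<in> I}"
  have fJ: "f ` J = I \<inter> f ` {..<length zs}" by (auto simp: J_def)
  have "[(\<Sum>j\<in>J. (w (f j) mod m) * zs ! j) = (\<Sum>j\<in>J. w (f j) * ys ! f j)] (mod m)"
    by (intro cong_sum cong_mult) (simp_all add: J_def f)
  also have "(\<Sum>j\<in>J. w (f j) * ys ! f j) = (\<Sum>i\<in>f ` J. w i * ys ! i)"
    using f(1) by (simp add: sum.reindex inj_on_subset)
  also have "[\<dots> = (\<Sum>i\<in>f ` J. w i * ys ! i) + (\<Sum>i\<in>I - f ` J. w i * ys ! i)] (mod m)"
  proof -
    have "m dvd (\<Sum>i\<in>I - f ` J. w i * ys ! i)" using zero fJ by (intro dvd_sum) auto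
    thus ?thesis by (simp add: cong_iff_dvd_diff)
  qed
  also have "(\<Sum>i\<in>f ` J. w i * ys ! i) + (\<Sum>i\<in>I - f ` J. w i * ys ! i) = (\<Sum>i\<in>I. w i * ys ! i)"
    using sum.subset_diff[of "f ` J" I "\<lambda>i. w i * ys ! i"] fin fJ by simp
  also have "[\<dots> = 0] (mod m)" using sum0 assms(1) cong_dvd_modulus by blast
  finally have "[(\<Sum>j\<in>J. (w (f j) mod m) * zs ! j) = 0] (mod m)" .
  moreover have "J \<noteq> {}" using fJ ne by auto
  ultimately show ?thesis unfolding has_wzs_def
    by (intro exI[of _ J] exI[of _ "\<lambda>j. w (f j) mod m"]) (auto simp: J_def intro: w)
qed

lemma has_wzs_take:
  assumes "has_wzs n A (take k xs)"
  shows "has_wzs n A xs"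
proof -
  obtain I w where I: "I \<subseteq> {..<length (take k xs)}" "I \<noteq> {}" "\<forall>i\<in>I. w i \<in> A"
    and "[(\<Sum>i\<in>I. w i * take k xs ! i) = 0] (mod n)"
    using assms by (auto simp: has_wzs_def)
  moreover have "(\<Sum>i\<in>I. w i * take k xs ! i) = (\<Sum>i\<in>I. w i * xs ! i)"
    using I(1) by (intro sum.cong) auto
  ultimately have "I \<subseteq> {..<length xs} \<and> I \<noteq> {} \<and> (\<forall>i\<in>I. w i \<in> A) \<and>
      [(\<Sum>i\<in>I. w i * xs ! i) = 0] (mod n)"
    by auto
  thus ?thesis unfolding has_wzs_def by blast
qed

text \<open>A smaller value of the constant would force a zero-sum into a prefix of
  \<open>xs\<close>, hence into \<open>xs\<close> itself.\<close>

lemma extremalI: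
  assumes "set xs \<subseteq> Zm n" "\<not> has_wzs n A xs"
    and "\<And>ys. length ys = Suc (length xs) \<Longrightarrow> set ys \<subseteq> Zm n \<Longrightarrow> has_wzs n A ys"
  shows "extremal n A xs"
proof -
  have "davenport n A = Suc (length xs)" unfolding davenport_def
  proof (rule Least_equality)
    show "\<forall>ys. length ys = Suc (length xs) \<and> set ys \<subseteq> Zm n \<longrightarrow> has_wzs n A ys"
      using assms(3) by blast
    fix k assume k: "\<forall>ys. length ys = k \<and> set ys \<subseteq> Zm n \<longrightarrow> has_wzs n A ys"
    show "Suc (length xs) \<le> k"
    proof (rule ccontr)
      assume "\<not> Suc (length xs) \<le> k"
      hence "length (take k xs) = k" by simp
      moreover have "set (take k xs) \<subseteq> Zm n" using assms(1) set_take_subset by fast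
      ultimately have "has_wzs n A (take k xs)" using k by blast
      thus False using has_wzs_take assms(2) by blast
    qed
  qed
  thus ?thesis using assms by (simp add: extremal_def)
qed

section \<open>The upper bound: any four terms contain a weighted zero-sum\<close>

lemma chinese_remainder_three_primes:
  fixes p q r :: int
  assumes "prime p" "prime q" "prime r" "p \<noteq> q" "p \<noteq> r" "q \<noteq> r"
  obtains a where "a \<in> {0..<r * (p * q)}" "[a = x] (mod p)" "[a = y] (mod q)" "[a = z] (mod r)"
proof -
  have "coprime p q" "coprime r (p * q)" using assms by (auto simp: primes_coprime)
  then obtain b where b: "[b = x] (mod p)" "[b = y] (mod q)"
    using binary_chinese_remainder_int by blast
  obtain a where a: "[a = z] (mod r)" "[a = b] (mod (p * q))"
    using binary_chinese_remainder_int[OF \<open>coprime r (p * q)\<close>] by blast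
  define c where "c = a mod (r * (p * q))"
  have c: "[c = a] (mod (r * (p * q)))" by (simp add: c_def)
  have "[c = a] (mod p)" "[c = a] (mod q)" "[c = a] (mod r)" "[a = b] (mod p)" "[a = b] (mod q)"
    by (rule cong_dvd_modulus[OF c], simp)+
      (rule cong_dvd_modulus[OF a(2)], simp)+
  hence "[c = x] (mod p)" "[c = y] (mod q)" "[c = z] (mod r)"
    using a b cong_trans by blast+
  moreover have "r * (p * q) > 0" using assms by (simp add: prime_gt_0_int)
  hence "c \<in> {0..<r * (p * q)}" by (simp add: c_def)
  ultimately show thesis using that by blast
qed

text \<open>One support \<open>I\<close> is chosen that suits all three primes; \<open>p\<close> and
  \<open>q\<close> get coupled weights, \<open>r\<close> gets unit weights, and the Chinese
  remainder theorem glues them into elements of the weight group.\<close>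

lemma L_grp_has_wzs:
  fixes p q r :: int
  assumes pr: "prime p" "prime q" "prime r" and ne: "p \<noteq> q" "p \<noteq> r" "q \<noteq> r"
    and ge: "7 \<le> p" "7 \<le> q" "7 \<le> r" and len: "4 \<le> length xs"
  shows "has_wzs (r * (p * q)) (L_grp (r * (p * q)) r) xs"
proof -
  let ?n = "r * (p * q)"
  have nd: "\<not> p dvd q" "\<not> r dvd p" "\<not> r dvd q" using pr ne by (auto dest: primes_dvd_imp_eq)
  have npos: "?n > 0" using pr by (simp add: prime_gt_0_int)
  define supp where "supp = (\<lambda>s. {i. \<not> s dvd xs ! i})"
  have supp: "I \<inter> supp s = {i \<in> I. \<not> s dvd xs ! i}" for I s by (auto simp: supp_def)
  obtain I where I: "I \<subseteq> {..<length xs}" "I \<noteq> {}" and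
    card: "card {i \<in> I. \<not> p dvd xs ! i} \<noteq> 1" "card {i \<in> I. \<not> q dvd xs ! i} \<noteq> 1"
      "card {i \<in> I. \<not> r dvd xs ! i} \<noteq> 1"
      "\<not> ({i \<in> I. \<not> p dvd xs ! i} = {i \<in> I. \<not> q dvd xs ! i} \<and> card {i \<in> I. \<not> p dvd xs ! i} = 2)"
    using subset_avoiding_three[of "{..<length xs}" "supp p" "supp q" "supp r"] len
    unfolding supp by auto
  have fin: "finite I" using I(1) finite_subset by blast
  obtain u v where uv: "[(\<Sum>i\<in>I. u i * xs ! i) = 0] (mod p)" "[(\<Sum>i\<in>I. v i * xs ! i) = 0] (mod q)"
      "\<And>i. Legendre (u i) p = Legendre (v i) q" "\<And>i. Legendre (u i) p \<noteq> 0"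
    using coupled_weights[OF pr(1) ge(1) pr(2) ge(2) fin card(1,2,4)] by blast
  obtain t where t: "\<And>i. \<not> r dvd t i" "[(\<Sum>i\<in>I. t i * xs ! i) = 0] (mod r)"
    using unit_weights[OF pr(3) ge(3) fin card(3)] by blast
  have "\<exists>a. a \<in> {0..<?n} \<and> [a = u i] (mod p) \<and> [a = v i] (mod q) \<and> [a = t i] (mod r)" for i
    using chinese_remainder_three_primes[OF pr ne] by metis
  then obtain w where w: "\<And>i. w i \<in> {0..<?n}" "\<And>i. [w i = u i] (mod p)"
    "\<And>i. [w i = v i] (mod q)" "\<And>i. [w i = t i] (mod r)" by metis
  have "w i \<in> L_grp ?n r" for i
  proof -
    have L: "Legendre (w i) p = Legendre (u i) p" "Legendre (w i) q = Legendre (u i) p"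
      using w[of i] uv(3)[of i] by (metis Legendre_cong)+
    hence nz: "\<not> p dvd w i" "\<not> q dvd w i" using uv(4)[of i] by (metis Legendre_eq_0_iff)+
    moreover have "\<not> r dvd w i" using w(4)[of i] t(1)[of i] by (simp add: cong_dvd_iff)
    ultimately have "coprime (w i) ?n"
      using pr by (auto simp: coprime_commute[of "w i"] intro: prime_imp_coprime)
    \<comment> \<open>Both Legendre symbols are the same sign, whose square is 1.\<close>
    moreover have "jacobi_sym (w i) (p * q) = 1"
      using L Legendre_cases[OF nz(1)] pr nd
      by (auto simp: jacobi_sym_prime_mult jacobi_sym_prime)
    ultimately show ?thesis
      using w(1)[of i] pr nd npos by (subst L_grp_eq) (auto simp: units_mod_def prime_dvd_mult_iff)
  qed
  moreover have "[(\<Sum>i\<in>I. w i * xs ! i) = 0] (mod ?n)"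
  proof -
    have "[(\<Sum>i\<in>I. w i * xs ! i) = (\<Sum>i\<in>I. u i * xs ! i)] (mod p)"
      "[(\<Sum>i\<in>I. w i * xs ! i) = (\<Sum>i\<in>I. v i * xs ! i)] (mod q)"
      "[(\<Sum>i\<in>I. w i * xs ! i) = (\<Sum>i\<in>I. t i * xs ! i)] (mod r)"
      by (intro cong_sum cong_mult w cong_refl)+
    hence "p dvd (\<Sum>i\<in>I. w i * xs ! i)" "q dvd (\<Sum>i\<in>I. w i * xs ! i)" "r dvd (\<Sum>i\<in>I. w i * xs ! i)"
      using uv t(2) by (simp_all add: cong_0_iff cong_dvd_iff)
    moreover have "coprime p q" "coprime r (p * q)" using pr ne by (auto simp: primes_coprime)
    ultimately show ?thesis by (simp add: cong_0_iff divides_mult)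
  qed
  ultimately show ?thesis using I unfolding has_wzs_def by blast
qed

section \<open>Extremality of the forms (i) and (ii)\<close>

lemma prime_factorization_three:
  assumes "n > 0" "squarefree n" "Omega n = 3" "prime r" "r dvd n"
  obtains p q where "prime p" "prime q" "p \<noteq> q" "p \<noteq> r" "q \<noteq> r" "n = r * (p * q)"
proof -
  have "r \<in># prime_factorization n" using assms by (simp add: in_prime_factors_iff)
  then obtain M where M: "prime_factorization n = add_mset r M" by (meson mset_add)
  hence "size M = 2" using assms(3) by (simp add: Omega_def)
  then obtain p N where p: "M = add_mset p N" "size N = 1"
    using size_eq_Suc_imp_eq_union[of M 1] by auto
  then obtain q where pq: "M = {#p, q#}"
    using size_1_singleton_mset[of N] by auto
  have n: "n = r * (p * q)"
    using prod_mset_prime_factorization[of n] assms(1) M pq by simp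
  have "p \<in># prime_factorization n" "q \<in># prime_factorization n" using M pq by simp_all
  hence pr: "prime p" "prime q" by auto
  have "\<not> x\<^sup>2 dvd n" if "prime x" for x
    using that assms(2) squarefreeD[of n x] not_prime_unit by blast
  from this[OF pr(1)] this[OF assms(4)] have "p \<noteq> q" "p \<noteq> r" "q \<noteq> r"
    using n by (auto simp: power2_eq_square)
  thus thesis using that pr n by blast
qed

text \<open>Modulo \<open>p\<close> only the term at \<open>k\<close> would survive, and it is
  nonzero. In form (ii) this excludes \<open>y1\<close>, at index 0.\<close>

lemma weighted_sum_coprime_term:
  fixes p :: int
  assumes "prime p" "finite I" "p dvd (\<Sum>i\<in>I. w i * x i)"
    and "\<And>i. i \<in> I \<Longrightarrow> i \<noteq> k \<Longrightarrow> p dvd x i" and "\<not> p dvd x k" "\<not> p dvd w k"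
  shows "k \<notin> I"
proof
  assume k: "k \<in> I"
  have "p dvd (\<Sum>i\<in>I - {k}. w i * x i)" using assms(4) by (intro dvd_sum) auto
  moreover have "(\<Sum>i\<in>I. w i * x i) = w k * x k + (\<Sum>i\<in>I - {k}. w i * x i)"
    using assms(2) k by (rule sum.remove)
  ultimately have "p dvd w k * x k" using assms(3) by (metis dvd_add_left_iff)
  thus False using assms(1,5,6) by (simp add: prime_dvd_mult_iff)
qed

theorem theorem5p4:
  fixes n p' :: int and S :: "int list"
  assumes "n > 0" and "odd n" and "squarefree n" and "Omega n = 3"
    and "\<forall>p. prime p \<and> p dvd n \<longrightarrow> p \<ge> 7"
    and "prime p'" and "p' dvd n"
    and "set S \<subseteq> Zm n"
    and "\<exists>y1 y2 y3. {y1, y2, y3} \<subseteq> Zm n \<and> equiv_wrt n (L_grp n p') S [y1, y2, y3] \<and>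
           ((y3 \<noteq> 0 \<and> (n div p') dvd y3 \<and>
             extremal (n div p') (S_grp (n div p')) [y1 mod (n div p'), y2 mod (n div p')])
            \<or>
            (\<exists>p. prime p \<and> p dvd n \<and> \<not> p dvd y1 \<and> p dvd y2 \<and> p dvd y3 \<and>
               (p \<noteq> p' \<longrightarrow>
                  extremal (n div p) (units_mod (n div p)) [y2 mod (n div p), y3 mod (n div p)]) \<and>
               (p = p' \<longrightarrow>
                  extremal (n div p) (S_grp (n div p)) [y2 mod (n div p), y3 mod (n div p)])))"
  shows "extremal n (L_grp n p') S"
proof -
  obtain p q where pq: "prime p" "prime q" "p \<noteq> q" "p \<noteq> p'" "q \<noteq> p'" and n: "n = p' * (p * q)"
    using prime_factorization_three[OF assms(1,3,4,6,7)] by blast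
  have ge: "7 \<le> p" "7 \<le> q" "7 \<le> p'" using assms(5,6) pq(1,2) n by auto
  have "\<not> p' dvd p" "\<not> p' dvd q" using pq assms(6) by (auto dest: primes_dvd_imp_eq)
  hence nd: "\<not> p' dvd n div p'" using assms(6) n ge(3) by (simp add: prime_dvd_mult_iff)
  note L = assms(6,7) nd assms(1)
  obtain y1 y2 y3 where y: "{y1, y2, y3} \<subseteq> Zm n" and
    eq: "equiv_wrt n (L_grp n p') S [y1, y2, y3]" and
    forms: "(y3 \<noteq> 0 \<and> (n div p') dvd y3 \<and>
             extremal (n div p') (S_grp (n div p')) [y1 mod (n div p'), y2 mod (n div p')])
            \<or>
            (\<exists>p. prime p \<and> p dvd n \<and> \<not> p dvd y1 \<and> p dvd y2 \<and> p dvd y3 \<and>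
               (p \<noteq> p' \<longrightarrow>
                  extremal (n div p) (units_mod (n div p)) [y2 mod (n div p), y3 mod (n div p)]) \<and>
               (p = p' \<longrightarrow>
                  extremal (n div p) (S_grp (n div p)) [y2 mod (n div p), y3 mod (n div p)]))"
    using assms(9) by blast
  have len: "length S = 3" using eq by (simp add: equiv_wrt_def)
  have coprime: "coprime a n" if "a \<in> L_grp n p'" for a
    using that by (simp add: L_grp_def units_mod_def)
  have div_pos: "n div s dvd n" "n div s > 0" if "s dvd n" "prime s" for s
    using that assms(1) prime_gt_0_int[of s] by (auto simp: dvd_def zero_less_mult_iff)
  have unit_red: "a mod (n div s) \<in> units_mod (n div s)" if "a \<in> L_grp n p'" "s dvd n" "prime s" for a s
    using that div_pos units_mod_reduce[of a n "n div s"] by (simp add: L_grp_def)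
  have "\<not> has_wzs n (L_grp n p') [y1, y2, y3]"
  proof
    assume "has_wzs n (L_grp n p') [y1, y2, y3]"
    then obtain I w where I: "I \<subseteq> {..<3}" "I \<noteq> {}" and w: "\<And>i. i \<in> I \<Longrightarrow> w i \<in> L_grp n p'"
      and sum0: "[(\<Sum>i\<in>I. w i * [y1, y2, y3] ! i) = 0] (mod n)"
      by (auto simp: has_wzs_def numeral_3_eq_3)
    have fin: "finite I" using I(1) finite_subset by blast
    have I3: "i = 0 \<or> i = 1 \<or> i = 2" if "i \<in> I" for i using I(1) that by auto
    from forms show False
    proof (elim disjE exE conjE)
      let ?m = "n div p'" and ?zs = "[y1 mod (n div p'), y2 mod (n div p')]"
      assume y3: "y3 \<noteq> 0" "?m dvd y3" and ext: "extremal ?m (S_grp ?m) ?zs"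
      show False
      \<comment> \<open>Either the sum involves \<open>y1\<close> or \<open>y2\<close> and projects
        to a zero-sum modulo \<open>n div p'\<close>, where \<open>y3\<close> vanishes, or it
        consists of \<open>y3\<close> alone.\<close>
      proof (cases "I \<inter> id ` {..<length ?zs} = {}")
        case True
        hence "I = {2}" using I(2) I3 by fastforce
        hence "n dvd w 2 * y3" "coprime (w 2) n" using sum0 w coprime by (simp_all add: cong_0_iff)
        \<comment> \<open>The weight of \<open>y3\<close> is a unit, so \<open>n\<close> would
          divide \<open>y3\<close> itself, a nonzero element of \<open>{0..<n}\<close>.\<close>
        hence "n dvd y3" by (simp add: coprime_commute coprime_dvd_mult_right_iff)
        moreover have "0 \<le> y3" "y3 < n" using y by (simp_all add: Zm_def)
        ultimately show False using y3(1) zdvd_not_zless by force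
      next
        case False
        have "has_wzs ?m (S_grp ?m) ?zs"
        proof (rule has_wzs_reduce[OF div_pos(1)[OF assms(7,6)] fin sum0 _ inj_on_id _ _ False])
          show "w i mod ?m \<in> S_grp ?m" if "i \<in> I" for i using L_grp_reduce[OF L w[OF that]] .
          show "?zs ! j = [y1, y2, y3] ! id j mod ?m" if "j < length ?zs" for j
            using that by (auto simp: less_Suc_eq)
          show "?m dvd [y1, y2, y3] ! i" if "i \<in> I" "i \<notin> id ` {..<length ?zs}" for i
            using that I3[of i] y3(2) by auto
        qed
        thus False using ext by (simp add: extremal_def)
      qed
    next
      fix s
      let ?m = "n div s" and ?zs = "[y2 mod (n div s), y3 mod (n div s)]"
      assume s: "prime s" "s dvd n" and ys: "\<not> s dvd y1" "s dvd y2" "s dvd y3"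
        and ext: "s \<noteq> p' \<longrightarrow> extremal ?m (units_mod ?m) ?zs" "s = p' \<longrightarrow> extremal ?m (S_grp ?m) ?zs"
      have "0 \<notin> I"
      proof
        assume 0: "0 \<in> I"
        have "\<not> s dvd w 0"
          using coprime[OF w[OF 0]] s not_coprimeI[of s "w 0" n] not_prime_unit by blast
        moreover have "s dvd (\<Sum>i\<in>I. w i * [y1, y2, y3] ! i)"
          using sum0 s(2) by (meson cong_0_iff dvd_trans)
        moreover have "s dvd [y1, y2, y3] ! i" if "i \<in> I" "i \<noteq> 0" for i
          using that I3[of i] ys by auto
        ultimately show False
          using weighted_sum_coprime_term[OF s(1) fin, of w "\<lambda>i. [y1, y2, y3] ! i" 0] ys(1) 0 by simp
      qed
      have range: "i \<in> Suc ` {..<length ?zs}" if "i \<in> I" for i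
        using that I3[of i] \<open>0 \<notin> I\<close> by (auto simp: image_iff less_Suc_eq numeral_2_eq_2)
      \<comment> \<open>The target \<open>B\<close> is left open: the projected weights lie in
        \<open>S_grp ?m\<close> when \<open>s = p'\<close>, and in \<open>units_mod ?m\<close> when
        \<open>s\<close> is another prime.\<close>
      have red: "has_wzs ?m B ?zs" if B: "\<And>a. a \<in> L_grp n p' \<Longrightarrow> a mod ?m \<in> B" for B
      proof (rule has_wzs_reduce[OF div_pos(1)[OF s(2,1)] fin sum0 _ inj_Suc])
        show "w i mod ?m \<in> B" if "i \<in> I" for i using B w[OF that] by blast
        show "?zs ! j = [y1, y2, y3] ! Suc j mod ?m" if "j < length ?zs" for j
          using that by (auto simp: less_Suc_eq)
        show "?m dvd [y1, y2, y3] ! i" if "i \<in> I" "i \<notin> Suc ` {..<length ?zs}" for i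
          using that range by blast
        show "I \<inter> Suc ` {..<length ?zs} \<noteq> {}" using I(2) range by blast
      qed
      show False
      proof (cases "s = p'")
        case True
        thus False using red[of "S_grp ?m"] L_grp_reduce[OF L] ext(2) by (simp add: extremal_def)
      next
        case False
        thus False using red[of "units_mod ?m"] unit_red s ext(1) by (simp add: extremal_def)
      qed
    qed
  qed
  \<comment> \<open>Equivalence would carry a zero-sum of \<open>S\<close> to one of
    \<open>[y1, y2, y3]\<close>.\<close>
  hence "\<not> has_wzs n (L_grp n p') S"
    using has_wzs_equiv[OF eq] L_grp_mult[OF L assms(2)] L_grp_inverse[OF L assms(2)] by metis
  \<comment> \<open>As \<open>S\<close> has three terms, a sequence longer by one has the four terms
    that the upper bound asks for.\<close>
  moreover have "has_wzs n (L_grp n p') ys" if "length ys = Suc (length S)" for ys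
    using L_grp_has_wzs[of p q p' ys] pq assms(6) ge that len n by simp
  ultimately show ?thesis using assms(8) by (intro extremalI)
qed

end
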